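(* Let $\chi:\mathbb{R}^2\to\mathbb{R}$ be a kernel as in the context, satisfying in addition the following moment condition (of order $r=2$): for every $(u,v)\in\mathbb{R}^2$ one has $m^{\eta}_{(p_1,p_2)}(\chi,u,v)=0$ for $\eta=p_1+p_2=1$, and $m^{\eta}_{(p_1,p_2)}(\chi,u,v)=c$ for $\eta=p_1+p_2=2$, where $c$ is a constant. Let $f\in C^2(\mathbb{R}^2)$ and suppose that $$\|S_wf-f\|_\infty=o(w^{-1})\quad\text{as } w\to+\infty.$$ Then $f(x,y)=g(y-x)$ for all $(x,y)\in\mathbb{R}^2$, for some function $g:\mathbb{R}\to\mathbb{R}$.
   Context: $C^r(\mathbb{R}^2)$ is the space of continuous functions $f:\mathbb{R}^2\to\mathbb{R}$ all of whose partial derivatives up to order $r$ (including $f$ itself) are continuous and bounded on $\mathbb{R}^2$. $\|\cdot\|_\infty$ is the supremum norm on $\mathbb{R}^2$. For $p=(p_1,p_2)\in\mathbb{N}_0^2$ with $p_1+p_2=\eta$, the algebraic and absolute moments of $\chi$ are $$m^{\eta}_{(p_1,p_2)}(\chi,u,v)=\sum_{k\in\mathbb{Z}}\sum_{j\in\mathbb{Z}}\chi(u-k,v-j)(u-k)^{p_1}(v-j)^{p_2},$$ $$M^{\eta}_{(p_1,p_2)}(\chi)=\sup_{(u,v)\in\mathbb{R}^2}\sum_{k\in\mathbb{Z}}\sum_{j\in\mathbb{Z}}|\chi(u-k,v-j)|\,|u-k|^{p_1}|v-j|^{p_2},\qquad M_\eta(\chi)=\max_{p_1+p_2=\eta}M^{\eta}_{(p_1,p_2)}(\chi).$$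 Standing assumptions on the kernel: $\chi\in C^0(\mathbb{R}^2)$ (continuous and bounded); (K1) $\chi$ is integrable and bounded at the origin; (K2) $\sum_{k\in\mathbb{Z}}\sum_{j\in\mathbb{Z}}\chi(u-k,v-j)=1$ for every $(u,v)\in\mathbb{R}^2$; (K3) $M_\eta(\chi)<+\infty$ for some $\eta=p_1+p_2$ with $p_1,p_2$ positive integers. For $w>0$ the bivariate Kantorovich type sampling series is $$(S_w f)(x,y)=\sum_{k\in\mathbb{Z}}\sum_{j\in\mathbb{Z}}\chi(wx-k,wy-j)\Bigg[w^2\int_{\frac kw}^{\frac{k+1}w}\int_{\frac jw}^{\frac{j+1}w}f(u,v)\,dv\,du\Bigg],$$ where $u$ ranges over $(\frac kw,\frac{k+1}w)$ and $v$ over $(\frac jw,\frac{j+1}w)$. *)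

theory Defs
  imports "HOL-Analysis.Analysis" "HOL-Library.Landau_Symbols"
begin

primrec C_bounded :: "nat \<Rightarrow> (real \<times> real \<Rightarrow> real) \<Rightarrow> bool" where
  "C_bounded 0 f \<longleftrightarrow> continuous_on UNIV f \<and> bounded (range f)"
| "C_bounded (Suc r) f \<longleftrightarrow> continuous_on UNIV f \<and> bounded (range f) \<and>
     (\<exists>f\<^sub>1 f\<^sub>2.
        (\<forall>x y. ((\<lambda>t. f (t, y)) has_real_derivative f\<^sub>1 (x, y)) (at x)) \<and>
        (\<forall>x y. ((\<lambda>t. f (x, t)) has_real_derivative f\<^sub>2 (x, y)) (at y)) \<and>
        C_bounded r f\<^sub>1 \<and> C_bounded r f\<^sub>2)"

definition algebraic_moment ::
    "(real \<times> real \<Rightarrow> real) \<Rightarrow> nat \<Rightarrow> nat \<Rightarrow> real \<Rightarrow> real \<Rightarrow> real" where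
  "algebraic_moment chi p\<^sub>1 p\<^sub>2 u v =
     (\<Sum>\<^sub>\<infinity>k. \<Sum>\<^sub>\<infinity>j.
        chi (u - of_int k, v - of_int j) * (u - of_int k) ^ p\<^sub>1 * (v - of_int j) ^ p\<^sub>2)"

text \<open>The absolute moments live in \<^typ>\<open>ennreal\<close>, where the sums and the supremum
  always exist and may be infinite.\<close>

definition absolute_moment ::
    "(real \<times> real \<Rightarrow> real) \<Rightarrow> nat \<Rightarrow> nat \<Rightarrow> ennreal" where
  "absolute_moment chi p\<^sub>1 p\<^sub>2 =
     (SUP (u, v) \<in> UNIV. \<Sum>\<^sub>\<infinity>k. \<Sum>\<^sub>\<infinity>j.
        ennreal (\<bar>chi (u - of_int k, v - of_int j)\<bar> *
                 \<bar>u - of_int k\<bar> ^ p\<^sub>1 * \<bar>v - of_int j\<bar> ^ p\<^sub>2))"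

definition absolute_moment_order :: "(real \<times> real \<Rightarrow> real) \<Rightarrow> nat \<Rightarrow> ennreal" where
  "absolute_moment_order chi \<eta> =
     (MAX (p\<^sub>1, p\<^sub>2) \<in> {(p\<^sub>1, p\<^sub>2). p\<^sub>1 + p\<^sub>2 = \<eta>}. absolute_moment chi p\<^sub>1 p\<^sub>2)"

definition sampling_kernel :: "(real \<times> real \<Rightarrow> real) \<Rightarrow> bool" where
  "sampling_kernel chi \<longleftrightarrow>
     C_bounded 0 chi \<and>
     integrable lborel chi \<and> (\<exists>e>0. bounded (chi ` ball 0 e)) \<and>
     (\<forall>u v. (\<Sum>\<^sub>\<infinity>k. \<Sum>\<^sub>\<infinity>j. chi (u - of_int k, v - of_int j)) = 1) \<and>
     (\<exists>p\<^sub>1 p\<^sub>2. 0 < p\<^sub>1 \<and> 0 < p\<^sub>2 \<and> absolute_moment_order chi (p\<^sub>1 + p\<^sub>2) < \<infinity>)"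

definition kantorovich_series ::
    "(real \<times> real \<Rightarrow> real) \<Rightarrow> real \<Rightarrow> (real \<times> real \<Rightarrow> real) \<Rightarrow> real \<times> real \<Rightarrow> real" where
  "kantorovich_series chi w f = (\<lambda>(x, y).
     \<Sum>\<^sub>\<infinity>k. \<Sum>\<^sub>\<infinity>j. chi (w * x - of_int k, w * y - of_int j) *
       (w\<^sup>2 * integral {of_int k / w .. (of_int k + 1) / w}
                (\<lambda>u. integral {of_int j / w .. (of_int j + 1) / w} (\<lambda>v. f (u, v)))))"

text \<open>This is the supremum norm only for bounded functions, since \<^const>\<open>Sup\<close> on the reals is
  unspecified on unbounded sets. For a sampling kernel and a bounded continuous
  \<open>f\<close>, \<open>kantorovich_series chi w f\<close> with \<open>w > 0\<close> is bounded: finiteness of one absolute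
  moment of order at least 2 and boundedness of the kernel bound the moment of order 0.\<close>

definition sup_norm :: "(real \<times> real \<Rightarrow> real) \<Rightarrow> real" where
  "sup_norm h = (SUP z. \<bar>h z\<bar>)"

end

theory Submission
  imports Defs
begin

text \<open>
  The theorem rests on a Voronovskaja-type expansion. Averaging the first-order
  Taylor polynomial of \<open>f\<close> at \<open>(x, y)\<close> over the cell \<open>[k/w, (k+1)/w] \<times> [j/w, (j+1)/w]\<close> amounts
  to evaluating it at the midpoint of the cell. In terms of \<open>a = w x - k\<close> and
  \<open>b = w y - j\<close>, this midpoint is displaced from \<open>(x, y)\<close> by \<open>(1/2 - a, 1/2 - b) / w\<close>. When
  the averages are summed against the kernel, the terms in \<open>a\<close> and \<open>b\<close> vanish, because the
  first-order moments are zero, but the half-cell shift survives: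
  \<open>S\<^sub>w f = f + (f\<^sub>1 + f\<^sub>2) / (2 w) + O(1 / w\<^sup>2)\<close>, uniformly in \<open>(x, y)\<close>, where \<open>f\<^sub>1, f\<^sub>2\<close> are
  the partial derivatives. This is \<open>kantorovich_voronovskaja\<close>. An error of order \<open>o(1 / w)\<close>
  therefore forces \<open>f\<^sub>1 + f\<^sub>2 = 0\<close>, so that the derivative of \<open>f\<close> in the direction \<open>(1, 1)\<close>
  vanishes and \<open>f\<close> depends on \<open>y - x\<close> alone (\<open>constant_along_diagonals\<close>).

  The remainder is controlled by the sums of \<open>\<bar>chi\<bar> (1 + a\<^sup>2 + b\<^sup>2)\<close> over the lattice, bounded
  uniformly in \<open>(x, y)\<close> and \<open>w\<close> by \<open>sampling_kernel_quadratic_weight\<close>. Finiteness of the absolute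
  moments of a single order \<open>n \<ge> 2\<close> suffices for that: away from the origin the pure powers
  \<open>\<bar>a\<bar> ^ n\<close> and \<open>\<bar>b\<bar> ^ n\<close> dominate all lower powers, and near the origin there are
  boundedly many lattice points, at which the kernel is bounded. The same bound makes every
  series involved absolutely summable, so the iterated sums can be treated as sums over
  \<open>\<int> \<times> \<int>\<close>.
\<close>

section \<open>Uniform decay of the kernel\<close>

text \<open>This weight dominates everything that occurs: the constant and linear terms of the
  expansion and the quadratic Taylor remainder.\<close>
definition quadratic_weight :: "(real \<times> real \<Rightarrow> real) \<Rightarrow> real \<Rightarrow> real \<Rightarrow> int \<times> int \<Rightarrow> real" where
  "quadratic_weight chi u v = (\<lambda>(k, j).
     \<bar>chi (u - of_int k, v - of_int j)\<bar> * (1 + (u - of_int k)\<^sup>2 + (v - of_int j)\<^sup>2))"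

lemma ennreal_finite_sum_le_infsum:
  fixes f :: "'a \<Rightarrow> ennreal"
  assumes "finite F" "F \<subseteq> A"
  shows "sum f F \<le> infsum f A"
proof -
  have "infsum f A = (SUP F\<in>{F. finite F \<and> F \<subseteq> A}. sum f F)"
    by (rule nonneg_infsum_complete) simp
  then show ?thesis using assms by (auto intro: SUP_upper)
qed

text \<open>Passing to finite sums transfers the moment bound from the iterated sums in the extended
  nonnegative reals to sums of real numbers over pairs: a finite set of pairs lies in a finite
  rectangle, whose sum is at most the iterated sum.\<close>
lemma absolute_moment_bounds_finite_sums:
  assumes fin: "absolute_moment chi p q < \<infinity>" and F: "finite F"
  shows "(\<Sum>(k,j)\<in>F. \<bar>chi (u - of_int k, v - of_int j)\<bar> * \<bar>u - of_int k\<bar> ^ p * \<bar>v - of_int j\<bar> ^ q)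
    \<le> enn2real (absolute_moment chi p q)" (is "(\<Sum>(k,j)\<in>F. ?a k j) \<le> _")
proof -
  let ?G = "\<lambda>k j. ennreal (?a k j)"
  have "ennreal (\<Sum>(k,j)\<in>F. ?a k j) = (\<Sum>(k,j)\<in>F. ?G k j)"
    by (subst sum_ennreal[symmetric]) (auto intro!: sum.cong)
  also have "\<dots> \<le> (\<Sum>(k,j)\<in>fst ` F \<times> snd ` F. ?G k j)"
    using F by (intro sum_mono2) (auto simp: rev_image_eqI)
  also have "\<dots> = (\<Sum>k\<in>fst ` F. \<Sum>j\<in>snd ` F. ?G k j)"
    by (simp only: sum.cartesian_product)
  also have "\<dots> \<le> (\<Sum>k\<in>fst ` F. \<Sum>\<^sub>\<infinity>j. ?G k j)"
    using F by (intro sum_mono ennreal_finite_sum_le_infsum) auto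
  also have "\<dots> \<le> (\<Sum>\<^sub>\<infinity>k. \<Sum>\<^sub>\<infinity>j. ?G k j)"
    using F by (intro ennreal_finite_sum_le_infsum) auto
  also have "\<dots> \<le> absolute_moment chi p q"
    unfolding absolute_moment_def by (rule SUP_upper2[of "(u,v)"]) auto
  finally have le: "ennreal (\<Sum>(k,j)\<in>F. ?a k j) \<le> absolute_moment chi p q" .
  have "absolute_moment chi p q = ennreal (enn2real (absolute_moment chi p q))"
    using fin by simp
  with le have "ennreal (\<Sum>(k,j)\<in>F. ?a k j) \<le> ennreal (enn2real (absolute_moment chi p q))" by simp
  then show ?thesis by (simp only: ennreal_le_iff[OF enn2real_nonneg])
qed

text \<open>All three terms on the left are at most \<open>max \<bar>a\<bar> \<bar>b\<bar> ^ n\<close>.\<close>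
lemma one_plus_squares_le:
  fixes a b :: real
  assumes n: "2 \<le> n" and far: "1 \<le> \<bar>a\<bar> \<or> 1 \<le> \<bar>b\<bar>"
  shows "1 + a\<^sup>2 + b\<^sup>2 \<le> 3 * (\<bar>a\<bar> ^ n + \<bar>b\<bar> ^ n)"
proof -
  define m where "m = max \<bar>a\<bar> \<bar>b\<bar>"
  have m: "1 \<le> m" "\<bar>a\<bar> \<le> m" "\<bar>b\<bar> \<le> m" using far by (auto simp: m_def)
  have "a\<^sup>2 \<le> m\<^sup>2" "b\<^sup>2 \<le> m\<^sup>2" using m by (auto simp: abs_le_square_iff[symmetric])
  moreover have "1 \<le> m\<^sup>2" "m\<^sup>2 \<le> m ^ n" using m n by (auto intro: power_increasing one_le_power)
  moreover have "m ^ n \<le> \<bar>a\<bar> ^ n + \<bar>b\<bar> ^ n" by (auto simp: m_def max_def)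
  ultimately have "1 + a\<^sup>2 + b\<^sup>2 \<le> 3 * m ^ n" "3 * m ^ n \<le> 3 * (\<bar>a\<bar> ^ n + \<bar>b\<bar> ^ n)" by simp_all
  then show ?thesis by (rule order_trans)
qed

text \<open>The lattice points with \<open>\<bar>u - k\<bar> < 1\<close> and \<open>\<bar>v - j\<bar> < 1\<close> are boundedly many and are handled
  by the bound on the kernel. At all other points the weight is dominated by the pure powers of
  order \<open>n\<close>, whose sums are the absolute moments \<open>(n, 0)\<close> and \<open>(0, n)\<close>; both are finite because
  the hypothesis on the kernel concerns the maximum over all splittings of \<open>n\<close>.\<close>
lemma sampling_kernel_quadratic_weight:
  assumes "sampling_kernel chi"
  obtains K where
    "\<And>u v. quadratic_weight chi u v summable_on UNIV"
    "\<And>u v. infsum (quadratic_weight chi u v) UNIV \<le> K"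
proof -
  from assms obtain B where B: "\<And>z. \<bar>chi z\<bar> \<le> B"
    by (auto simp: sampling_kernel_def bounded_iff)
  from assms obtain p q where pq: "0 < p" "0 < q"
    and fin: "absolute_moment_order chi (p + q) < \<infinity>"
    by (auto simp: sampling_kernel_def)
  define n where "n = p + q"
  have n: "2 \<le> n" using pq by (simp add: n_def)
  have fin_split: "finite {(p1, p2). p1 + p2 = n}"
    by (rule finite_subset[of _ "{..n} \<times> {..n}"]) auto
  have fin_mom: "absolute_moment chi r s < \<infinity>" if "r + s = n" for r s
  proof -
    have "absolute_moment chi r s \<le> absolute_moment_order chi n"
      unfolding absolute_moment_order_def using that
      by (intro Max_ge finite_imageI fin_split) force
    then show ?thesis using fin by (auto simp: n_def intro: le_less_trans)
  qed
  define L where "L = 3 * (enn2real (absolute_moment chi n 0) + enn2real (absolute_moment chi 0 n))"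
  (* At most 9 near points, each of weight at most 3 * B. *)
  define K where "K = L + 27 * B"
  have B0: "0 \<le> B" using B[of 0] by linarith
  have bound: "sum (quadratic_weight chi u v) F \<le> K" if F: "finite F" for u v and F :: "(int \<times> int) set"
  proof -
    define near where "near = {(k::int, j::int). \<bar>u - of_int k\<bar> < 1 \<and> \<bar>v - of_int j\<bar> < 1}"
    have near_sub: "near \<subseteq> {\<lfloor>u\<rfloor> - 1..\<lfloor>u\<rfloor> + 1} \<times> {\<lfloor>v\<rfloor> - 1..\<lfloor>v\<rfloor> + 1}"
      unfolding near_def by (auto; linarith)
    then have fin_near: "finite near" by (rule finite_subset) auto
    have "card near \<le> card ({\<lfloor>u\<rfloor> - 1..\<lfloor>u\<rfloor> + 1} \<times> {\<lfloor>v\<rfloor> - 1..\<lfloor>v\<rfloor> + 1})"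
      by (rule card_mono[OF _ near_sub]) auto
    then have card_near: "card near \<le> 9" by simp
    let ?a = "\<lambda>(k, j). \<bar>chi (u - of_int k, v - of_int j)\<bar> * \<bar>u - of_int k\<bar> ^ n * \<bar>v - of_int j\<bar> ^ 0"
    let ?b = "\<lambda>(k, j). \<bar>chi (u - of_int k, v - of_int j)\<bar> * \<bar>u - of_int k\<bar> ^ 0 * \<bar>v - of_int j\<bar> ^ n"
    have "sum (quadratic_weight chi u v) (F - near) \<le> (\<Sum>z\<in>F - near. 3 * (?a z + ?b z))"
    proof (rule sum_mono)
      fix z assume "z \<in> F - near"
      then obtain k j where z: "z = (k, j)" and far: "(k, j) \<notin> near" by (cases z) auto
      have "1 + (u - of_int k)\<^sup>2 + (v - of_int j)\<^sup>2 \<le> 3 * (\<bar>u - of_int k\<bar> ^ n + \<bar>v - of_int j\<bar> ^ n)"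
        by (rule one_plus_squares_le[OF n]) (use far in \<open>auto simp: near_def\<close>)
      from mult_left_mono[OF this, of "\<bar>chi (u - of_int k, v - of_int j)\<bar>"]
      show "quadratic_weight chi u v z \<le> 3 * (?a z + ?b z)"
        by (simp add: z quadratic_weight_def algebra_simps)
    qed
    also have "\<dots> = 3 * (sum ?a (F - near) + sum ?b (F - near))"
      by (simp only: sum_distrib_left[symmetric] sum.distrib)
    also have "\<dots> \<le> L"
      unfolding L_def
      by (intro mult_left_mono add_mono absolute_moment_bounds_finite_sums fin_mom)
         (use F in auto)
    finally have far_part: "sum (quadratic_weight chi u v) (F - near) \<le> L" .
    have "sum (quadratic_weight chi u v) (F \<inter> near) \<le> of_nat (card (F \<inter> near)) * (3 * B)"
    proof (rule sum_bounded_above, clarify)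
      fix k j :: int assume "(k, j) \<in> near"
      then have "(u - of_int k)\<^sup>2 \<le> 1" "(v - of_int j)\<^sup>2 \<le> 1"
        by (auto simp: near_def abs_square_le_1)
      then have "\<bar>chi (u - of_int k, v - of_int j)\<bar> * (1 + (u - of_int k)\<^sup>2 + (v - of_int j)\<^sup>2) \<le> B * 3"
        by (intro mult_mono B) (auto simp: B0)
      then show "quadratic_weight chi u v (k, j) \<le> 3 * B" by (simp add: quadratic_weight_def)
    qed
    also have "\<dots> \<le> 9 * (3 * B)"
    proof (rule mult_right_mono)
      have "card (F \<inter> near) \<le> card near" by (rule card_mono[OF fin_near]) auto
      with card_near show "real (card (F \<inter> near)) \<le> 9" by linarith
    qed (use B0 in auto)
    finally have near_part: "sum (quadratic_weight chi u v) (F \<inter> near) \<le> 27 * B" by simp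
    have "sum (quadratic_weight chi u v) F
        = sum (quadratic_weight chi u v) (F \<inter> near) + sum (quadratic_weight chi u v) (F - near)"
      using F by (rule sum.Int_Diff)
    with far_part near_part show ?thesis by (simp add: K_def)
  qed
  have summable: "quadratic_weight chi u v summable_on UNIV" for u v
  proof (rule nonneg_bdd_above_summable_on)
    show "0 \<le> quadratic_weight chi u v z" for z by (auto simp: quadratic_weight_def split: prod.split)
    show "bdd_above (sum (quadratic_weight chi u v) ` {F. F \<subseteq> UNIV \<and> finite F})"
      by (rule bdd_aboveI2[of _ _ K]) (auto intro: bound)
  qed
  show thesis
    by (rule that[OF summable infsum_le_finite_sums[OF summable]]) (auto intro: bound)
qed

lemma quadratic_weight_dominated:
  fixes h :: "int \<times> int \<Rightarrow> real"
  assumes W: "quadratic_weight chi u v summable_on UNIV"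
    and h: "\<And>z. \<bar>h z\<bar> \<le> C * quadratic_weight chi u v z"
  shows "h summable_on UNIV" "\<bar>infsum h UNIV\<bar> \<le> C * infsum (quadratic_weight chi u v) UNIV"
proof -
  have CW: "(\<lambda>z. C * quadratic_weight chi u v z) summable_on UNIV"
    using W by (rule summable_on_cmult_right)
  have abs: "(\<lambda>z. norm (h z)) summable_on UNIV"
    by (rule Infinite_Sum.abs_summable_on_comparison_test'[OF CW]) (use h in auto)
  then show "h summable_on UNIV" by (rule abs_summable_summable)
  have "norm (infsum h UNIV) \<le> infsum (\<lambda>z. norm (h z)) UNIV"
    using abs by (rule norm_infsum_bound)
  also have "\<dots> \<le> infsum (\<lambda>z. C * quadratic_weight chi u v z) UNIV"
    by (rule infsum_mono[OF abs CW]) (use h in auto)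
  also have "\<dots> = C * infsum (quadratic_weight chi u v) UNIV" by (rule infsum_cmult_right')
  finally show "\<bar>infsum h UNIV\<bar> \<le> C * infsum (quadratic_weight chi u v) UNIV" by simp
qed

lemma kernel_mult_le_quadratic_weight:
  assumes "\<bar>r\<bar> \<le> C * (1 + (u - of_int k)\<^sup>2 + (v - of_int j)\<^sup>2)"
  shows "\<bar>chi (u - of_int k, v - of_int j) * r\<bar> \<le> C * quadratic_weight chi u v (k, j)"
  using mult_left_mono[OF assms, of "\<bar>chi (u - of_int k, v - of_int j)\<bar>"]
  by (simp add: quadratic_weight_def abs_mult algebra_simps)

lemma infsum_pair:
  fixes h :: "int \<times> int \<Rightarrow> real"
  assumes "h summable_on UNIV"
  shows "(\<Sum>\<^sub>\<infinity>k. \<Sum>\<^sub>\<infinity>j. h (k, j)) = infsum h UNIV"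
  using infsum_Sigma'_banach[of "\<lambda>k j. h (k, j)" UNIV "\<lambda>_. UNIV"] assms by simp

section \<open>Taylor expansion and cell averages\<close>

text \<open>The increment is split into a horizontal step from \<open>(x, v)\<close> to \<open>(u, v)\<close> and a vertical step
  from \<open>(x, y)\<close> to \<open>(x, v)\<close>. Each is handled by the one-dimensional mean value theorem, where the
  partial derivatives of \<open>f\<close> vary in a Lipschitz manner because the second-order ones are
  bounded.\<close>
lemma C2_taylor:
  assumes "C_bounded 2 f"
  obtains f1 f2 A C where "\<And>z. \<bar>f1 z + f2 z\<bar> \<le> A" "0 \<le> C"
    "\<And>x y u v. \<bar>f (u, v) - f (x, y) - f1 (x, y) * (u - x) - f2 (x, y) * (v - y)\<bar>
       \<le> C * ((u - x)\<^sup>2 + (v - y)\<^sup>2)"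
proof -
  from assms obtain f1 f2 where
    d1: "\<And>x y. ((\<lambda>t. f (t, y)) has_real_derivative f1 (x, y)) (at x)" and
    d2: "\<And>x y. ((\<lambda>t. f (x, t)) has_real_derivative f2 (x, y)) (at y)" and
    C1: "C_bounded 1 f1" "C_bounded 1 f2"
    by (auto simp: numeral_2_eq_2)
  from C1(1) obtain f11 f12 where
    d11: "\<And>x y. ((\<lambda>t. f1 (t, y)) has_real_derivative f11 (x, y)) (at x)" and
    d12: "\<And>x y. ((\<lambda>t. f1 (x, t)) has_real_derivative f12 (x, y)) (at y)" and
    b1: "bounded (range f1)" "bounded (range f11)" "bounded (range f12)"
    by auto
  from C1(2) obtain f22 where
    d22: "\<And>x y. ((\<lambda>t. f2 (x, t)) has_real_derivative f22 (x, y)) (at y)" and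
    b2: "bounded (range f2)" "bounded (range f22)"
    by auto
  obtain A1 A2 where A: "\<And>z. \<bar>f1 z\<bar> \<le> A1" "\<And>z. \<bar>f2 z\<bar> \<le> A2"
    using b1 b2 by (auto simp: bounded_iff)
  obtain D1 D2 D3 where D123: "\<And>z. \<bar>f11 z\<bar> \<le> D1" "\<And>z. \<bar>f12 z\<bar> \<le> D2" "\<And>z. \<bar>f22 z\<bar> \<le> D3"
    using b1 b2 by (auto simp: bounded_iff)
  define D where "D = max D1 (max D2 D3)"
  have D: "\<bar>f11 z\<bar> \<le> D" "\<bar>f12 z\<bar> \<le> D" "\<bar>f22 z\<bar> \<le> D" for z
    using D123[of z] by (auto simp: D_def)
  have D0: "0 \<le> D" using D(1)[of 0] by linarith
  (* The mean value theorem for g with the affine function of slope m subtracted; m = 0 gives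
     Lipschitz bounds, and m the value of a derivative at the base point gives Taylor bounds. *)
  have mvt: "\<bar>g s - g t - m * (s - t)\<bar> \<le> M * \<bar>s - t\<bar>"
    if der: "\<And>r. (g has_real_derivative g' r) (at r)"
      and bd: "\<And>r. \<bar>r - t\<bar> \<le> \<bar>s - t\<bar> \<Longrightarrow> \<bar>g' r - m\<bar> \<le> M" for g g' :: "real \<Rightarrow> real" and s t m M
  proof -
    have "norm ((g s - m * s) - (g t - m * t)) \<le> M * norm (s - t)"
    proof (rule field_differentiable_bound[of "closed_segment t s" "\<lambda>r. g r - m * r" "\<lambda>r. g' r - m"])
      show "((\<lambda>r. g r - m * r) has_real_derivative g' r - m) (at r within closed_segment t s)" for r
        by (rule has_field_derivative_at_within) (auto intro!: derivative_eq_intros der)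
      show "norm (g' r - m) \<le> M" if "r \<in> closed_segment t s" for r
        using that by (auto simp: closed_segment_eq_real_ivl split: if_splits intro!: bd)
    qed auto
    then show ?thesis by (simp add: algebra_simps)
  qed
  have lip: "\<bar>f1 (r, v) - f1 (x, y)\<bar> \<le> D * (\<bar>r - x\<bar> + \<bar>v - y\<bar>)" for r v x y
  proof -
    have "\<bar>f1 (r, v) - f1 (x, v)\<bar> \<le> D * \<bar>r - x\<bar>"
      using mvt[of "\<lambda>t. f1 (t, v)" "\<lambda>t. f11 (t, v)" x r 0 D] d11 D by simp
    moreover have "\<bar>f1 (x, v) - f1 (x, y)\<bar> \<le> D * \<bar>v - y\<bar>"
      using mvt[of "\<lambda>t. f1 (x, t)" "\<lambda>t. f12 (x, t)" y v 0 D] d12 D by simp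
    ultimately show ?thesis by (simp add: distrib_left)
  qed
  have taylor: "\<bar>f (u, v) - f (x, y) - f1 (x, y) * (u - x) - f2 (x, y) * (v - y)\<bar>
       \<le> 2 * D * ((u - x)\<^sup>2 + (v - y)\<^sup>2)" for x y u v
  proof -
    have h: "\<bar>f (u, v) - f (x, v) - f1 (x, y) * (u - x)\<bar> \<le> D * (\<bar>u - x\<bar> + \<bar>v - y\<bar>) * \<bar>u - x\<bar>"
    proof (rule mvt[OF d1])
      fix r assume "\<bar>r - x\<bar> \<le> \<bar>u - x\<bar>"
      then have "D * (\<bar>r - x\<bar> + \<bar>v - y\<bar>) \<le> D * (\<bar>u - x\<bar> + \<bar>v - y\<bar>)"
        using D0 by (intro mult_left_mono) auto
      with lip[of r v x y] show "\<bar>f1 (r, v) - f1 (x, y)\<bar> \<le> D * (\<bar>u - x\<bar> + \<bar>v - y\<bar>)" by linarith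
    qed
    have w: "\<bar>f (x, v) - f (x, y) - f2 (x, y) * (v - y)\<bar> \<le> D * \<bar>v - y\<bar> * \<bar>v - y\<bar>"
    proof (rule mvt[OF d2])
      fix r assume r: "\<bar>r - y\<bar> \<le> \<bar>v - y\<bar>"
      have "\<bar>f2 (x, r) - f2 (x, y)\<bar> \<le> D * \<bar>r - y\<bar>"
        using mvt[of "\<lambda>t. f2 (x, t)" "\<lambda>t. f22 (x, t)" y r 0 D] d22 D by simp
      also have "\<dots> \<le> D * \<bar>v - y\<bar>" using r D0 by (intro mult_left_mono) auto
      finally show "\<bar>f2 (x, r) - f2 (x, y)\<bar> \<le> D * \<bar>v - y\<bar>" .
    qed
    define a b where "a = \<bar>u - x\<bar>" and "b = \<bar>v - y\<bar>"
    let ?r = "f (u, v) - f (x, y) - f1 (x, y) * (u - x) - f2 (x, y) * (v - y)"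
    have "\<bar>?r\<bar> \<le> D * (a + b) * a + D * b * b"
      unfolding a_def b_def using h w by linarith
    also have "\<dots> = D * (a\<^sup>2 + a * b + b\<^sup>2)" by (simp add: power2_eq_square algebra_simps)
    also have "\<dots> \<le> D * (2 * (a\<^sup>2 + b\<^sup>2))"
    proof (rule mult_left_mono[OF _ D0])
      have "0 \<le> a * b" by (simp add: a_def b_def)
      then have "a * b \<le> a\<^sup>2 + b\<^sup>2" using sum_squares_bound[of a b] by linarith
      then show "a\<^sup>2 + a * b + b\<^sup>2 \<le> 2 * (a\<^sup>2 + b\<^sup>2)" by (simp add: distrib_left)
    qed
    also have "D * (2 * (a\<^sup>2 + b\<^sup>2)) = 2 * D * ((u - x)\<^sup>2 + (v - y)\<^sup>2)"
      by (simp only: a_def b_def power2_abs mult_ac)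
    finally show ?thesis .
  qed
  show thesis
  proof (rule that)
    show "\<bar>f1 z + f2 z\<bar> \<le> A1 + A2" for z using A[of z] by linarith
    show "0 \<le> 2 * D" using D0 by simp
  qed (rule taylor)
qed

lemma integral_near_affine:
  fixes g :: "real \<Rightarrow> real"
  assumes ab: "a \<le> b" and g: "continuous_on {a..b} g"
    and M: "\<And>t. t \<in> {a..b} \<Longrightarrow> \<bar>g t - (p + q * t)\<bar> \<le> M"
  shows "\<bar>integral {a..b} g - (b - a) * (p + q * ((a + b) / 2))\<bar> \<le> M * (b - a)"
proof -
  have "((\<lambda>t. p + q * t) has_integral (b - a) * (p + q * ((a + b) / 2))) {a..b}"
  proof -
    have "((\<lambda>t. p + q * t) has_integral (p * b + q * b\<^sup>2 / 2) - (p * a + q * a\<^sup>2 / 2)) {a..b}"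
      by (rule fundamental_theorem_of_calculus[OF ab])
         (auto intro!: derivative_eq_intros simp flip: has_real_derivative_iff_has_vector_derivative)
    also have "(p * b + q * b\<^sup>2 / 2) - (p * a + q * a\<^sup>2 / 2) = (b - a) * (p + q * ((a + b) / 2))"
      by (simp add: field_simps power2_eq_square)
    finally show ?thesis .
  qed
  then have rest: "((\<lambda>t. g t - (p + q * t)) has_integral
      integral {a..b} g - (b - a) * (p + q * ((a + b) / 2))) {a..b}"
    using g by (intro has_integral_diff integrable_integral integrable_continuous_real)
  have "0 \<le> M" using M[of a] ab by force
  then have "norm (integral {a..b} g - (b - a) * (p + q * ((a + b) / 2))) \<le> M * measure lborel {a..b}"
    by (rule has_integral_bound_real[OF _ finite.emptyI rest]) (use M in auto)
  then show ?thesis using ab by simp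
qed

lemma cell_average_near_affine:
  fixes f :: "real \<times> real \<Rightarrow> real"
  assumes f: "continuous_on UNIV f" and ab: "a \<le> b" "c \<le> d"
    and M: "\<And>u v. u \<in> {a..b} \<Longrightarrow> v \<in> {c..d} \<Longrightarrow> \<bar>f (u, v) - (p + q * u + r * v)\<bar> \<le> M"
  shows "\<bar>integral {a..b} (\<lambda>u. integral {c..d} (\<lambda>v. f (u, v)))
      - (b - a) * (d - c) * (p + q * ((a + b) / 2) + r * ((c + d) / 2))\<bar> \<le> M * (b - a) * (d - c)"
proof -
  let ?I = "\<lambda>u. integral {c..d} (\<lambda>v. f (u, v))"
  have cont: "continuous_on {a..b} ?I"
    using integral_continuous_on_param[of "{a..b}" c d "\<lambda>u v. f (u, v)"]
    by (auto intro: continuous_on_subset[OF f] simp: case_prod_unfold)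
  have "\<bar>?I u - ((d - c) * (p + r * ((c + d) / 2)) + ((d - c) * q) * u)\<bar> \<le> M * (d - c)"
    if "u \<in> {a..b}" for u
  proof -
    have "\<bar>?I u - (d - c) * ((p + q * u) + r * ((c + d) / 2))\<bar> \<le> M * (d - c)"
      using that M
      by (intro integral_near_affine ab continuous_on_compose2[OF f]) (auto intro!: continuous_intros)
    then show ?thesis by (simp add: algebra_simps)
  qed
  from integral_near_affine[OF ab(1) cont this]
  have "\<bar>integral {a..b} ?I - (b - a) * ((d - c) * (p + r * ((c + d) / 2)) + (d - c) * q * ((a + b) / 2))\<bar>
    \<le> M * (d - c) * (b - a)" .
  moreover have "(b - a) * ((d - c) * (p + r * ((c + d) / 2)) + (d - c) * q * ((a + b) / 2))
      = (b - a) * (d - c) * (p + q * ((a + b) / 2) + r * ((c + d) / 2))"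
    by (simp only: distrib_left mult_ac add_ac)
  ultimately show ?thesis by (simp only: mult_ac)
qed


text \<open>The midpoint of the cell is \<open>((k + 1/2) / w, (j + 1/2) / w)\<close>, and the halves produce the term
  \<open>(p + q) / (2 w)\<close>. A point of the cell has distance at most \<open>(1 + \<bar>w x - k\<bar>) / w\<close> from \<open>x\<close> in
  the first coordinate, and similarly in the second, which bounds the Taylor remainder.\<close>
lemma kantorovich_cell_average:
  fixes f :: "real \<times> real \<Rightarrow> real" and k j :: int
  assumes f: "continuous_on UNIV f" and w: "0 < w" and C: "0 \<le> C"
    and taylor: "\<And>u v. \<bar>f (u, v) - f (x, y) - p * (u - x) - q * (v - y)\<bar>
       \<le> C * ((u - x)\<^sup>2 + (v - y)\<^sup>2)"
  shows "\<bar>w\<^sup>2 * integral {of_int k / w .. (of_int k + 1) / w}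
        (\<lambda>u. integral {of_int j / w .. (of_int j + 1) / w} (\<lambda>v. f (u, v)))
      - (f (x, y) + (p + q) / (2 * w) - p / w * (w * x - of_int k) - q / w * (w * y - of_int j))\<bar>
    \<le> 4 * C / w\<^sup>2 * (1 + (w * x - of_int k)\<^sup>2 + (w * y - of_int j)\<^sup>2)"
    (is "\<bar>w\<^sup>2 * ?I - ?A\<bar> \<le> ?R")
proof -
  have sq: "(t - z)\<^sup>2 \<le> 2 * (1 + (w * z - of_int i)\<^sup>2) / w\<^sup>2"
    if "t \<in> {of_int i / w .. (of_int i + 1) / w}" for t z :: real and i :: int
  proof -
    (* e is the position inside the cell, rescaled to [0, 1]. *)
    define e where "e = w * t - of_int i"
    have "0 \<le> e" "e \<le> 1" using that w by (auto simp: e_def field_simps)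
    then have "e\<^sup>2 \<le> 1" by (simp add: power_le_one)
    moreover have "0 \<le> (e + (w * z - of_int i))\<^sup>2" by simp
    ultimately have "(e - (w * z - of_int i))\<^sup>2 \<le> 2 * (1 + (w * z - of_int i)\<^sup>2)"
      by (simp add: power2_eq_square algebra_simps)
    moreover have "e - (w * z - of_int i) = w * (t - z)" by (simp add: e_def algebra_simps)
    ultimately have "w\<^sup>2 * (t - z)\<^sup>2 \<le> 2 * (1 + (w * z - of_int i)\<^sup>2)" by (simp add: power_mult_distrib)
    then show ?thesis using w by (simp add: field_simps)
  qed
  have "\<bar>f (u, v) - ((f (x, y) - p * x - q * y) + p * u + q * v)\<bar> \<le> ?R"
    if u: "u \<in> {of_int k / w .. (of_int k + 1) / w}" and v: "v \<in> {of_int j / w .. (of_int j + 1) / w}" for u v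
  proof -
    have "\<bar>f (u, v) - ((f (x, y) - p * x - q * y) + p * u + q * v)\<bar> \<le> C * ((u - x)\<^sup>2 + (v - y)\<^sup>2)"
      using taylor[of u v] by (simp add: algebra_simps)
    also have "\<dots> \<le> C * (2 * (1 + (w * x - of_int k)\<^sup>2) / w\<^sup>2 + 2 * (1 + (w * y - of_int j)\<^sup>2) / w\<^sup>2)"
      by (intro mult_left_mono add_mono sq u v C)
    also have "\<dots> = C * ((4 + 2 * (w * x - of_int k)\<^sup>2 + 2 * (w * y - of_int j)\<^sup>2) / w\<^sup>2)"
      by (simp add: add_divide_distrib[symmetric])
    also have "\<dots> \<le> C * ((4 * (1 + (w * x - of_int k)\<^sup>2 + (w * y - of_int j)\<^sup>2)) / w\<^sup>2)"
      by (intro mult_left_mono divide_right_mono C) auto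
    finally show ?thesis by (simp add: mult.assoc mult.left_commute)
  qed
  from cell_average_near_affine[OF f _ _ this]
  have I: "\<bar>?I - ((of_int k + 1) / w - of_int k / w) * ((of_int j + 1) / w - of_int j / w) *
        ((f (x, y) - p * x - q * y) + p * ((of_int k / w + (of_int k + 1) / w) / 2)
          + q * ((of_int j / w + (of_int j + 1) / w) / 2))\<bar>
      \<le> ?R * ((of_int k + 1) / w - of_int k / w) * ((of_int j + 1) / w - of_int j / w)"
    using w by (simp add: divide_right_mono)
  have len: "(of_int i + 1) / w - of_int i / w = 1 / w" for i :: int by (simp add: diff_divide_distrib[symmetric])
  have A: "(f (x, y) - p * x - q * y) + p * ((of_int k / w + (of_int k + 1) / w) / 2)
          + q * ((of_int j / w + (of_int j + 1) / w) / 2) = ?A"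
    using w by (simp add: field_simps)
  have "\<bar>?I - 1 / w * (1 / w) * ?A\<bar> \<le> ?R * (1 / w) * (1 / w)" using I unfolding len A .
  then have "w\<^sup>2 * \<bar>?I - 1 / w * (1 / w) * ?A\<bar> \<le> w\<^sup>2 * (?R * (1 / w) * (1 / w))"
    by (rule mult_left_mono) simp
  moreover have "w\<^sup>2 * \<bar>?I - 1 / w * (1 / w) * ?A\<bar> = \<bar>w\<^sup>2 * (?I - 1 / w * (1 / w) * ?A)\<bar>"
    by (simp add: abs_mult)
  moreover have "w\<^sup>2 * (?I - 1 / w * (1 / w) * ?A) = w\<^sup>2 * ?I - ?A"
    using w by (simp add: right_diff_distrib power2_eq_square)
  moreover have "w\<^sup>2 * (?R * (1 / w) * (1 / w)) = ?R"
    using w by (simp add: power2_eq_square)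
  ultimately show ?thesis by simp
qed

section \<open>The Voronovskaja-type expansion and its consequence\<close>

text \<open>The moments of order 0 and 1 evaluate the affine part of the cell averages exactly, and the
  quadratic weight bounds what is left.\<close>
lemma kantorovich_voronovskaja:
  fixes f chi :: "real \<times> real \<Rightarrow> real"
  assumes W: "\<And>u v. quadratic_weight chi u v summable_on UNIV"
    and K: "\<And>u v. infsum (quadratic_weight chi u v) UNIV \<le> K"
    and m00: "\<And>u v. algebraic_moment chi 0 0 u v = 1"
    and m10: "\<And>u v. algebraic_moment chi 1 0 u v = 0"
    and m01: "\<And>u v. algebraic_moment chi 0 1 u v = 0"
    and f: "continuous_on UNIV f" and w: "0 < w" and C: "0 \<le> C"
    and taylor: "\<And>u v. \<bar>f (u, v) - f (x, y) - p * (u - x) - q * (v - y)\<bar>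
       \<le> C * ((u - x)\<^sup>2 + (v - y)\<^sup>2)"
  shows "\<bar>kantorovich_series chi w f (x, y) - f (x, y) - (p + q) / (2 * w)\<bar> \<le> 4 * C * K / w\<^sup>2"
proof -
  define A where "A = f (x, y) + (p + q) / (2 * w)"
  define X where "X = (\<lambda>(k::int, j::int). chi (w * x - of_int k, w * y - of_int j))"
  define X1 where "X1 = (\<lambda>(k::int, j::int). chi (w * x - of_int k, w * y - of_int j) * (w * x - of_int k))"
  define X2 where "X2 = (\<lambda>(k::int, j::int). chi (w * x - of_int k, w * y - of_int j) * (w * y - of_int j))"
  define I where "I = (\<lambda>(k::int, j::int). w\<^sup>2 * integral {of_int k / w .. (of_int k + 1) / w}
        (\<lambda>u. integral {of_int j / w .. (of_int j + 1) / w} (\<lambda>v. f (u, v))))"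
  define R where "R = (\<lambda>(k::int, j::int). I (k, j)
     - (A - p / w * (w * x - of_int k) - q / w * (w * y - of_int j)))"
  let ?W = "quadratic_weight chi (w * x) (w * y)"
  have abs_le: "\<bar>t\<bar> \<le> 1 + t\<^sup>2" for t :: real
  proof -
    have "2 * \<bar>t\<bar> \<le> \<bar>t\<bar>\<^sup>2 + 1" using sum_squares_bound[of "\<bar>t\<bar>" 1] by simp
    then show ?thesis by simp
  qed
  have X_le: "\<bar>X z\<bar> \<le> 1 * ?W z" for z
    using kernel_mult_le_quadratic_weight[of 1 1 "w * x" "fst z" "w * y" "snd z" chi]
    by (simp add: X_def case_prod_unfold)
  have X1_le: "\<bar>X1 z\<bar> \<le> 1 * ?W z" for z
    using kernel_mult_le_quadratic_weight[of "w * x - of_int (fst z)" 1 "w * x" "fst z" "w * y" "snd z" chi]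
      abs_le[of "w * x - of_int (fst z)"]
    by (simp add: X1_def case_prod_unfold add_increasing2)
  have X2_le: "\<bar>X2 z\<bar> \<le> 1 * ?W z" for z
    using kernel_mult_le_quadratic_weight[of "w * y - of_int (snd z)" 1 "w * x" "fst z" "w * y" "snd z" chi]
      order_trans[OF abs_le[of "w * y - of_int (snd z)"],
        of "1 + (w * x - of_int (fst z))\<^sup>2 + (w * y - of_int (snd z))\<^sup>2"]
    by (simp add: X2_def case_prod_unfold)
  have XR_le: "\<bar>X z * R z\<bar> \<le> 4 * C / w\<^sup>2 * ?W z" for z
  proof -
    obtain k j where z: "z = (k, j)" by (cases z)
    have "\<bar>R (k, j)\<bar> \<le> 4 * C / w\<^sup>2 * (1 + (w * x - of_int k)\<^sup>2 + (w * y - of_int j)\<^sup>2)"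
      using kantorovich_cell_average[OF f w C taylor, of k j] by (simp add: R_def I_def A_def)
    from kernel_mult_le_quadratic_weight[OF this, of chi] show ?thesis by (simp add: z X_def)
  qed
  note sX = quadratic_weight_dominated(1)[OF W X_le]
   and sX1 = quadratic_weight_dominated(1)[OF W X1_le]
   and sX2 = quadratic_weight_dominated(1)[OF W X2_le]
   and sXR = quadratic_weight_dominated(1)[OF W XR_le]
  have iX: "infsum X UNIV = 1"
    using m00[of "w * x" "w * y"] infsum_pair[OF sX] by (simp add: algebraic_moment_def X_def)
  have iX1: "infsum X1 UNIV = 0"
    using m10[of "w * x" "w * y"] infsum_pair[OF sX1] by (simp add: algebraic_moment_def X1_def)
  have iX2: "infsum X2 UNIV = 0"
    using m01[of "w * x" "w * y"] infsum_pair[OF sX2] by (simp add: algebraic_moment_def X2_def)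
  have split: "X z * I z = A * X z + (- p / w) * X1 z + (- q / w) * X2 z + X z * R z" for z
    by (cases z) (simp add: X_def X1_def X2_def R_def algebra_simps)
  have "((\<lambda>z. X z * I z) has_sum A * 1 + (- p / w) * 0 + (- q / w) * 0 + infsum (\<lambda>z. X z * R z) UNIV) UNIV"
    unfolding split using sX sX1 sX2 sXR iX iX1 iX2
    by (intro has_sum_add has_sum_cmult_right has_sum_infsum) (metis has_sum_infsum)+
  then have sXI: "(\<lambda>z. X z * I z) summable_on UNIV"
    and iXI: "infsum (\<lambda>z. X z * I z) UNIV = A + infsum (\<lambda>z. X z * R z) UNIV"
    by (auto simp: summable_on_def dest: infsumI)
  have "kantorovich_series chi w f (x, y) = infsum (\<lambda>z. X z * I z) UNIV"
    using infsum_pair[OF sXI] by (simp add: kantorovich_series_def X_def I_def)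
  then have "kantorovich_series chi w f (x, y) - f (x, y) - (p + q) / (2 * w) = infsum (\<lambda>z. X z * R z) UNIV"
    by (simp add: iXI A_def)
  moreover have "\<bar>infsum (\<lambda>z. X z * R z) UNIV\<bar> \<le> 4 * C / w\<^sup>2 * infsum ?W UNIV"
    by (rule quadratic_weight_dominated(2)[OF W XR_le])
  moreover have "4 * C / w\<^sup>2 * infsum ?W UNIV \<le> 4 * C / w\<^sup>2 * K"
    using C by (intro mult_left_mono K) auto
  ultimately show ?thesis by simp
qed

text \<open>Along a diagonal the linear part of the expansion cancels, so increments are quadratically
  small and the derivative of the restriction vanishes.\<close>
lemma constant_along_diagonals:
  fixes f :: "real \<times> real \<Rightarrow> real"
  assumes "\<And>x y u v. \<bar>f (u, v) - f (x, y) - f1 (x, y) * (u - x) - f2 (x, y) * (v - y)\<bar>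
       \<le> C * ((u - x)\<^sup>2 + (v - y)\<^sup>2)"
    and "\<And>z. f1 z + f2 z = 0"
  shows "f (x, y) = f (0, y - x)"
proof -
  define g where "g t = f (t, t + (y - x))" for t
  have diag: "\<bar>g s - g t\<bar> \<le> 2 * C * (s - t)\<^sup>2" for s t
  proof -
    have "f1 (t, t + (y - x)) * (s - t) + f2 (t, t + (y - x)) * (s - t) = 0"
      using assms(2)[of "(t, t + (y - x))"] by (simp flip: distrib_right)
    with assms(1)[of s "s + (y - x)" t "t + (y - x)"] show ?thesis by (simp add: g_def)
  qed
  have "(g has_real_derivative 0) (at t)" for t
  proof -
    have "((\<lambda>h. (g (t + h) - g t) / h) \<longlongrightarrow> 0) (at 0)"
    proof (rule Lim_null_comparison)
      have "\<bar>(g (t + h) - g t) / h\<bar> \<le> 2 * C * \<bar>h\<bar>" if "h \<noteq> 0" for h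
        using diag[of "t + h" t] that
        by (simp add: abs_divide divide_le_eq power2_eq_square mult.assoc flip: abs_mult)
      then show "\<forall>\<^sub>F h in at 0. norm ((g (t + h) - g t) / h) \<le> 2 * C * \<bar>h\<bar>"
        by (auto simp: eventually_at_filter)
      show "((\<lambda>h. 2 * C * \<bar>h\<bar>) \<longlongrightarrow> 0) (at 0)"
        by (rule tendsto_eq_intros refl | simp)+
    qed
    then show ?thesis by (simp add: DERIV_def)
  qed
  then have "g x = g 0" by (intro DERIV_isconst_all) auto
  then show ?thesis by (simp add: g_def)
qed

theorem theorem4:
  fixes chi f :: "real \<times> real \<Rightarrow> real" and c :: real
  assumes "sampling_kernel chi"
    and "\<And>p\<^sub>1 p\<^sub>2 u v. p\<^sub>1 + p\<^sub>2 = 1 \<Longrightarrow> algebraic_moment chi p\<^sub>1 p\<^sub>2 u v = 0"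
    and "\<And>p\<^sub>1 p\<^sub>2 u v. p\<^sub>1 + p\<^sub>2 = 2 \<Longrightarrow> algebraic_moment chi p\<^sub>1 p\<^sub>2 u v = c"
    and "C_bounded 2 f"
    and "(\<lambda>w. sup_norm (\<lambda>z. kantorovich_series chi w f z - f z)) \<in> o[at_top](\<lambda>w. 1 / w)"
  shows "\<exists>g :: real \<Rightarrow> real. \<forall>x y. f (x, y) = g (y - x)"
proof -
  obtain K where W: "\<And>u v. quadratic_weight chi u v summable_on UNIV"
    and K: "\<And>u v. infsum (quadratic_weight chi u v) UNIV \<le> K"
    using sampling_kernel_quadratic_weight[OF assms(1)] by blast
  obtain f1 f2 A C where A: "\<And>z. \<bar>f1 z + f2 z\<bar> \<le> A" and C: "0 \<le> C"
    and taylor: "\<And>x y u v. \<bar>f (u, v) - f (x, y) - f1 (x, y) * (u - x) - f2 (x, y) * (v - y)\<bar>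
       \<le> C * ((u - x)\<^sup>2 + (v - y)\<^sup>2)"
    using C2_taylor[OF assms(4)] by blast
  have f: "continuous_on UNIV f" using assms(4) by (simp add: numeral_2_eq_2)
  have m00: "algebraic_moment chi 0 0 u v = 1" for u v
    using assms(1) by (simp add: sampling_kernel_def algebraic_moment_def)
  define err where "err w z = kantorovich_series chi w f z - f z" for w z
  have voronovskaja: "\<bar>err w z - (f1 z + f2 z) / (2 * w)\<bar> \<le> 4 * C * K / w\<^sup>2" if w: "0 < w" for w z
  proof (cases z)
    case (Pair x y)
    show ?thesis
      using kantorovich_voronovskaja[OF W K m00 assms(2) assms(2) f w C taylor[where x = x and y = y]]
      by (simp add: err_def Pair)
  qed
  have err_le: "\<bar>err w z\<bar> \<le> sup_norm (err w)" if w: "0 < w" for w z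
    (* The expansion also shows that the error is bounded; without this the supremum would
       be unspecified and would not bound the values. *)
    unfolding sup_norm_def
  proof (rule cSUP_upper)
    show "bdd_above (range (\<lambda>z. \<bar>err w z\<bar>))"
    proof (rule bdd_aboveI2)
      fix z
      have "\<bar>(f1 z + f2 z) / (2 * w)\<bar> \<le> A / (2 * w)"
        using A[of z] w by (simp add: divide_right_mono)
      with voronovskaja[OF w, of z] show "\<bar>err w z\<bar> \<le> A / (2 * w) + 4 * C * K / w\<^sup>2" by linarith
    qed
  qed simp
  have "f1 z + f2 z = 0" for z
  proof -
    have "((\<lambda>w. sup_norm (err w) / (1 / w)) \<longlongrightarrow> 0) at_top"
      using assms(5) by (intro smalloD_tendsto) (simp add: err_def[abs_def])
    moreover have "((\<lambda>w. 4 * C * K / w) \<longlongrightarrow> 0) at_top"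
      by (intro tendsto_divide_0[OF tendsto_const] filterlim_at_top_imp_at_infinity filterlim_ident)
    ultimately have "((\<lambda>w. sup_norm (err w) / (1 / w) + 4 * C * K / w) \<longlongrightarrow> 0 + 0) at_top"
      by (rule tendsto_add)
    moreover have "\<forall>\<^sub>F w in at_top. \<bar>f1 z + f2 z\<bar> / 2 \<le> sup_norm (err w) / (1 / w) + 4 * C * K / w"
      using eventually_gt_at_top[of 0]
    proof eventually_elim
      case (elim w)
      have "\<bar>(f1 z + f2 z) / (2 * w)\<bar> \<le> sup_norm (err w) + 4 * C * K / w\<^sup>2"
        using voronovskaja[OF elim, of z] err_le[OF elim, of z] by linarith
      from mult_left_mono[OF this, of w] show ?case
        using elim by (simp add: abs_divide power2_eq_square algebra_simps)
    qed
    ultimately have "\<bar>f1 z + f2 z\<bar> / 2 \<le> 0 + 0"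
      by (rule tendsto_lowerbound) simp
    then show ?thesis by simp
  qed
  with taylor have "f (x, y) = f (0, y - x)" for x y
    by (rule constant_along_diagonals)
  then show ?thesis by (intro exI[of _ "\<lambda>s. f (0, s)"]) blast
qed

end
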